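(* Let $N\in\{2,3\}$, $g\in L^1([0,1])$, $\lambda\in\mathbb{R}$, and set $h_1(t)=e^{(N-3)t}\int_0^{e^{-t}}g(s)\,ds$ for $t\ge 0$. Suppose that $$\lambda h_1(t)\le\frac{N-1}{2}\qquad\text{for all } t>0.$$ Then the boundary value problem $$-w''+(N-2)w'+(N-1)w=\frac{N-1}{2}e^{-t}w^2+\lambda h_1(t)\quad (t>0),\qquad w(0)=0,\quad \lim_{t\to\infty}w(t)=0,$$ has at least one solution $w:[0,\infty)\to\mathbb{R}$.
   Context: A solution is a function $w\in C^2([0,\infty))$ satisfying the equation pointwise together with the two boundary conditions (note that $h_1$ is continuous). *)

theory Defs
  imports "HOL-Analysis.Analysis"
begin

definition h1 :: "nat \<Rightarrow> (real \<Rightarrow> real) \<Rightarrow> real \<Rightarrow> real" where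
  "h1 N g t = exp ((real N - 3) * t) * (LINT s:{0..exp (- t)}|lebesgue. g s)"

(* w is of class C^2 on [0,\<infinity>), with first and second derivatives w1 and w2.
   Derivatives are taken within {0..}: one-sided at 0, ordinary two-sided at t > 0. *)
definition C2_halfline_derivs :: "(real \<Rightarrow> real) \<Rightarrow> (real \<Rightarrow> real) \<Rightarrow> (real \<Rightarrow> real) \<Rightarrow> bool" where
  "C2_halfline_derivs w w1 w2 \<longleftrightarrow>
     (\<forall>t\<ge>0. (w has_real_derivative w1 t) (at t within {0..})) \<and>
     (\<forall>t\<ge>0. (w1 has_real_derivative w2 t) (at t within {0..})) \<and>
     continuous_on {0..} w2"

(* Values of w on negative arguments are irrelevant: every clause depends only on
   the restriction of w to {0..}. *)
definition bvp_solution :: "nat \<Rightarrow> (real \<Rightarrow> real) \<Rightarrow> real \<Rightarrow> (real \<Rightarrow> real) \<Rightarrow> bool" where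
  "bvp_solution N g lam w \<longleftrightarrow>
     (\<exists>w1 w2. C2_halfline_derivs w w1 w2 \<and>
        (\<forall>t>0. - w2 t + (real N - 2) * w1 t + (real N - 1) * w t
                 = (real N - 1) / 2 * exp (- t) * (w t)\<^sup>2 + lam * h1 N g t)) \<and>
     w 0 = 0 \<and> (w \<longlongrightarrow> 0) at_top"

end

theory Submission
  imports Defs
begin

text \<open>
  Write \<open>\<beta> = N - 1\<close> and \<open>f = lam * h1\<close>. The constants \<open>-m\<close>, with \<open>m\<close> large, and \<open>1\<close> are a sub- and a
  supersolution; the latter uses \<open>f \<le> \<beta> / 2\<close>. Adding \<open>M w\<close> to both sides of the equation makes the
  right-hand side increasing in \<open>w \<in> [-m, 1]\<close>, and the left-hand side factors as
  \<open>- (D - b) (D + a) w\<close> with \<open>a, b > 0\<close>. Inverting the factor \<open>D - b\<close> by integration from infinity and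
  the factor \<open>D + a\<close> by integration from \<open>0\<close> are positive operations, so the resulting fixed point
  map is monotone on \<open>[-m, 1]\<close>. Its iterates from \<open>-m\<close> increase to a fixed point by dominated
  convergence, and the integral representation gives the regularity. For the decay, go back to the
  unshifted equation: \<open>u = w' + w\<close> is a bounded solution of \<open>u' = \<beta> u - H\<close> with \<open>H \<rightarrow> 0\<close>, which forces
  \<open>u \<rightarrow> 0\<close> and then \<open>w \<rightarrow> 0\<close>.
\<close>

section \<open>Integral inverses of the first-order factors \<open>D - b\<close> and
  \<open>D + a\<close>\<close>

definition bwd :: "real \<Rightarrow> (real \<Rightarrow> real) \<Rightarrow> real \<Rightarrow> real" where
  "bwd b F t = exp (b * t) * integral {t..} (\<lambda>s. exp (- b * s) * F s)"

text \<open>Variation of constants for \<open>w' + a w = v\<close>. Starting the integral at 0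
  builds the boundary condition \<open>w 0 = 0\<close> into every iterate.\<close>

definition fwd :: "real \<Rightarrow> (real \<Rightarrow> real) \<Rightarrow> real \<Rightarrow> real" where
  "fwd a v t = exp (- a * t) * integral {0..t} (\<lambda>s. exp (a * s) * v s)"

lemma integral_has_real_derivative_halfline:
  fixes g :: "real \<Rightarrow> real"
  assumes "continuous_on {0..} g" "t \<ge> 0"
  shows "((\<lambda>x. integral {0..x} g) has_real_derivative g t) (at t within {0..})"
proof -
  have "((\<lambda>x. integral {0..x} g) has_real_derivative g t) (at t within {0..t+1})"
    using assms by (intro integral_has_real_derivative continuous_on_subset[OF assms(1)]) auto
  \<comment> \<open>The compact interval reaches past \<open>t\<close>, so both filters agree near
    \<open>t\<close>. This covers the one-sided derivative at 0 and the two-sided one for positive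
    \<open>t\<close>.\<close>
  also have "at t within {0..t+1} = at t within {0..}"
    by (rule at_within_nhd[of t "{..<t+1}"]) auto
  finally show ?thesis .
qed

lemma has_real_derivative_halfline_imp_continuous_on:
  fixes g :: "real \<Rightarrow> real"
  assumes "\<And>t. t \<ge> 0 \<Longrightarrow> (g has_real_derivative g' t) (at t within {0..})"
  shows "continuous_on {0..} g"
  using assms by (intro DERIV_continuous_on[where D=g']) auto

lemma bwd_integrable:
  fixes F :: "real \<Rightarrow> real"
  assumes "b > 0" "continuous_on {0..} F" "\<And>s. s \<ge> 0 \<Longrightarrow> \<bar>F s\<bar> \<le> k" "t \<ge> 0"
  shows "(\<lambda>s. exp (- b * s) * F s) integrable_on {t..}"
proof (rule measurable_bounded_by_integrable_imp_integrable)
  show sets: "{t..} \<in> sets lebesgue"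
    by (intro sets_completionI_sets) simp
  have "continuous_on {0..} (\<lambda>s. exp (- b * s) * F s)"
    by (intro continuous_intros assms(2))
  then have "continuous_on {t..} (\<lambda>s. exp (- b * s) * F s)"
    by (rule continuous_on_subset) (use assms(4) in auto)
  then show "(\<lambda>s. exp (- b * s) * F s) \<in> borel_measurable (lebesgue_on {t..})"
    by (rule continuous_imp_measurable_on_sets_lebesgue[OF _ sets])
  show "(\<lambda>s. exp (- b * s) * k) integrable_on {t..}"
    using integrable_on_exp_minus_to_infinity[OF assms(1), of t] by (rule integrable_on_mult_left)
  show "norm (exp (- b * s) * F s) \<le> exp (- b * s) * k" if "s \<in> {t..}" for s
    using assms(3)[of s] assms(4) that by (simp add: abs_mult)
qed

lemma bwd_const: "b > 0 \<Longrightarrow> bwd b (\<lambda>_. k) t = k / b"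
  using integral_unique[OF has_integral_exp_minus_to_infinity[of b t]]
  by (simp add: bwd_def exp_minus)

lemma bwd_mono:
  assumes "(\<lambda>s. exp (- b * s) * F s) integrable_on {t..}"
    and "(\<lambda>s. exp (- b * s) * G s) integrable_on {t..}"
    and "\<And>s. s \<ge> t \<Longrightarrow> F s \<le> G s"
  shows "bwd b F t \<le> bwd b G t"
  unfolding bwd_def using assms by (intro mult_left_mono integral_le) auto

lemma bwd_has_derivative:
  assumes F: "continuous_on {0..} F"
    and int: "\<And>t. t \<ge> 0 \<Longrightarrow> (\<lambda>s. exp (- b * s) * F s) integrable_on {t..}" and t: "t \<ge> 0"
  shows "(bwd b F has_real_derivative b * bwd b F t - F t) (at t within {0..})"
proof -
  let ?g = "\<lambda>s. exp (- b * s) * F s"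
  have cont: "continuous_on {0..} ?g"
    by (intro continuous_intros F)
  \<comment> \<open>The tail becomes a constant minus an integral from 0, to which the fundamental
    theorem of calculus applies.\<close>
  have split: "integral {x..} ?g = integral {0..} ?g - integral {0..x} ?g" if "x \<ge> 0" for x
  proof -
    have i1: "?g integrable_on {0..x}"
      by (rule integrable_on_subinterval[OF int[of 0]]) auto
    have "integral ({0..x} \<union> {x..}) ?g = integral {0..x} ?g + integral {x..} ?g"
      using that by (intro integral_Un i1 int negligible_subset[OF negligible_sing[of x]]) auto
    moreover have "{0..x} \<union> {x..} = {0..}" using that by auto
    ultimately show ?thesis by simp
  qed
  have cancel: "exp (b * t) * ?g t = F t"
    by (simp add: exp_minus)
  have "((\<lambda>x. exp (b * x) * (integral {0..} ?g - integral {0..x} ?g)) has_real_derivative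
          b * (exp (b * t) * (integral {0..} ?g - integral {0..t} ?g)) - exp (b * t) * ?g t)
          (at t within {0..})"
    by (rule derivative_eq_intros refl integral_has_real_derivative_halfline cont t)+
      (simp add: algebra_simps)
  then have "((\<lambda>x. exp (b * x) * (integral {0..} ?g - integral {0..x} ?g)) has_real_derivative
          b * bwd b F t - F t) (at t within {0..})"
    unfolding cancel split[OF t, symmetric] bwd_def .
  then show ?thesis
  proof (rule has_field_derivative_transform_within[where d=1])
    show "exp (b * x) * (integral {0..} ?g - integral {0..x} ?g) = bwd b F x" if "x \<in> {0..}" for x
      using that split[of x] unfolding bwd_def by simp
  qed (use t in auto)
qed

text \<open>Dominated convergence with majorant \<open>exp (- b * s) * k\<close>. No continuity of
  \<open>G\<close> is assumed: it will be a pointwise limit of iterates, and its integrability is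
  part of the conclusion.\<close>

lemma bwd_tendsto:
  assumes b: "b > 0" and F: "\<And>n. continuous_on {0..} (F n)"
    and bd: "\<And>n s. s \<ge> 0 \<Longrightarrow> \<bar>F n s\<bar> \<le> k"
    and conv: "\<And>s. s \<ge> 0 \<Longrightarrow> (\<lambda>n. F n s) \<longlonglongrightarrow> G s" and t: "t \<ge> 0"
  shows "(\<lambda>s. exp (- b * s) * G s) integrable_on {t..}"
    and "(\<lambda>n. bwd b (F n) t) \<longlonglongrightarrow> bwd b G t"
proof -
  have h: "(\<lambda>s. exp (- b * s) * k) integrable_on {t..}"
    using integrable_on_exp_minus_to_infinity[OF b, of t] by (rule integrable_on_mult_left)
  have le: "norm (exp (- b * s) * F n s) \<le> exp (- b * s) * k" if "s \<in> {t..}" for n s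
    using bd[of s n] t that by (simp add: abs_mult)
  have lim: "(\<lambda>n. exp (- b * s) * F n s) \<longlonglongrightarrow> exp (- b * s) * G s" if "s \<in> {t..}" for s
    using t that by (intro tendsto_intros conv) auto
  note dc = dominated_convergence[OF bwd_integrable[OF b F bd t] h le lim]
  show "(\<lambda>s. exp (- b * s) * G s) integrable_on {t..}"
    by (rule dc(1)) auto
  show "(\<lambda>n. bwd b (F n) t) \<longlonglongrightarrow> bwd b G t"
    unfolding bwd_def by (intro tendsto_intros dc(2)) auto
qed

lemma fwd_integrable:
  fixes v :: "real \<Rightarrow> real"
  assumes "continuous_on {0..} v"
  shows "(\<lambda>s. exp (a * s) * v s) integrable_on {0..t}"
proof -
  have "continuous_on {0..} (\<lambda>s. exp (a * s) * v s)"
    by (intro continuous_intros assms)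
  then have "continuous_on {0..t} (\<lambda>s. exp (a * s) * v s)"
    by (rule continuous_on_subset) auto
  then show ?thesis by (rule integrable_continuous_real)
qed

lemma fwd_const:
  assumes "a > 0" "t \<ge> 0"
  shows "fwd a (\<lambda>_. k) t = k * (1 - exp (- a * t)) / a"
proof -
  have "((\<lambda>s. exp (a * s)) has_integral (exp (a * t) / a - exp (a * 0) / a)) {0..t}"
    using assms
    by (intro fundamental_theorem_of_calculus)
      (auto intro!: derivative_eq_intros simp flip: has_real_derivative_iff_has_vector_derivative)
  then have "integral {0..t} (\<lambda>s. exp (a * s)) = (exp (a * t) - 1) / a"
    by (simp add: integral_unique diff_divide_distrib)
  then show ?thesis
    by (simp add: fwd_def exp_minus field_simps)
qed

lemma fwd_mono:
  assumes "(\<lambda>s. exp (a * s) * u s) integrable_on {0..t}"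
    and "(\<lambda>s. exp (a * s) * v s) integrable_on {0..t}"
    and "\<And>s. s \<in> {0..t} \<Longrightarrow> u s \<le> v s"
  shows "fwd a u t \<le> fwd a v t"
  unfolding fwd_def using assms by (intro mult_left_mono integral_le) auto

text \<open>An indefinite integral is continuous as soon as the integrand is integrable. Asking no
  more of \<open>v\<close> is what later upgrades a mere pointwise limit to a continuous
  function.\<close>

lemma fwd_continuous:
  assumes "\<And>t. t \<ge> 0 \<Longrightarrow> (\<lambda>s. exp (a * s) * v s) integrable_on {0..t}"
  shows "continuous_on {0..} (fwd a v)"
proof -
  have "continuous (at t within {0..}) (\<lambda>x. integral {0..x} (\<lambda>s. exp (a * s) * v s))"
    if t: "t \<ge> 0" for t
  proof -
    have "continuous (at t within {0..t+1}) (\<lambda>x. integral {0..x} (\<lambda>s. exp (a * s) * v s))"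
      using indefinite_integral_continuous_1[OF assms[of "t+1"]] t
      by (auto simp: continuous_on_eq_continuous_within)
    also have "at t within {0..t+1} = at t within {0..}"
      by (rule at_within_nhd[of t "{..<t+1}"]) auto
    finally show ?thesis .
  qed
  then have "continuous_on {0..} (\<lambda>x. integral {0..x} (\<lambda>s. exp (a * s) * v s))"
    by (auto simp: continuous_on_eq_continuous_within)
  then show ?thesis
    unfolding fwd_def by (intro continuous_intros)
qed

lemma fwd_has_derivative:
  assumes v: "continuous_on {0..} v" and t: "t \<ge> 0"
  shows "(fwd a v has_real_derivative v t - a * fwd a v t) (at t within {0..})"
proof -
  have cont: "continuous_on {0..} (\<lambda>s. exp (a * s) * v s)"
    by (intro continuous_intros v)
  show ?thesis
    unfolding fwd_def
    by (rule derivative_eq_intros refl integral_has_real_derivative_halfline cont t)+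
      (simp add: algebra_simps flip: exp_add)
qed

lemma fwd_tendsto:
  assumes v: "\<And>n. continuous_on {0..} (v n)"
    and bd: "\<And>n s. s \<ge> 0 \<Longrightarrow> \<bar>v n s\<bar> \<le> k"
    and conv: "\<And>s. s \<ge> 0 \<Longrightarrow> (\<lambda>n. v n s) \<longlonglongrightarrow> u s"
  shows "(\<lambda>s. exp (a * s) * u s) integrable_on {0..t}"
    and "(\<lambda>n. fwd a (v n) t) \<longlonglongrightarrow> fwd a u t"
proof -
  have h: "(\<lambda>s. exp (a * s) * k) integrable_on {0..t}"
    by (intro integrable_continuous_real continuous_intros)
  have le: "norm (exp (a * s) * v n s) \<le> exp (a * s) * k" if "s \<in> {0..t}" for n s
    using bd[of s n] that by (simp add: abs_mult)
  have lim: "(\<lambda>n. exp (a * s) * v n s) \<longlonglongrightarrow> exp (a * s) * u s" if "s \<in> {0..t}" for s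
    using that by (intro tendsto_intros conv) auto
  note dc = dominated_convergence[OF fwd_integrable[OF v] h le lim]
  show "(\<lambda>s. exp (a * s) * u s) integrable_on {0..t}"
    by (rule dc(1)) auto
  show "(\<lambda>n. fwd a (v n) t) \<longlonglongrightarrow> fwd a u t"
    unfolding fwd_def by (intro tendsto_intros dc(2)) auto
qed

section \<open>Decay at infinity for the first-order factors\<close>

lemma bounded_backward_le:
  fixes u H :: "real \<Rightarrow> real"
  assumes \<beta>: "\<beta> > 0" and du: "\<And>t. t > 0 \<Longrightarrow> (u has_real_derivative \<beta> * u t - H t) (at t)"
    and bd: "\<And>t. t > 0 \<Longrightarrow> \<bar>u t\<bar> \<le> k" and T: "T > 0" and H: "\<And>t. t \<ge> T \<Longrightarrow> H t \<le> e"
  shows "u T \<le> e / \<beta>"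
proof -
  \<comment> \<open>The integrating factor gives
    \<open>q' = exp (- \<beta> * t) * (e - H t)\<close>, which is nonnegative from \<open>T\<close>
    on. Boundedness of \<open>u\<close> forces \<open>q\<close> to 0 at infinity, so a nondecreasing
    \<open>q\<close> cannot be positive at \<open>T\<close>.\<close>
  define q where "q t = exp (- \<beta> * t) * (u t - e / \<beta>)" for t
  have mono: "q T \<le> q t" if "t \<ge> T" for t
  proof (rule DERIV_nonneg_imp_nondecreasing[OF that])
    fix x assume x: "T \<le> x" "x \<le> t"
    have "(q has_real_derivative exp (- \<beta> * x) * (e - H x)) (at x)"
      unfolding q_def using x T \<beta>
      by (auto intro!: derivative_eq_intros du simp: field_simps)
    then show "\<exists>y. DERIV q x :> y \<and> y \<ge> 0"
      using H[OF x(1)] by (intro exI[of _ "exp (- \<beta> * x) * (e - H x)"]) auto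
  qed
  have "(q \<longlongrightarrow> 0) at_top"
  proof (rule Lim_null_comparison)
    show "\<forall>\<^sub>F t in at_top. norm (q t) \<le> exp (- \<beta> * t) * (k + \<bar>e / \<beta>\<bar>)"
      using eventually_gt_at_top[of 0]
    proof eventually_elim
      case (elim t)
      have "\<bar>u t - e / \<beta>\<bar> \<le> k + \<bar>e / \<beta>\<bar>" using bd[OF elim] by linarith
      then show ?case unfolding q_def by (simp add: abs_mult del: abs_divide)
    qed
    have "filterlim (\<lambda>t. - \<beta> * t) at_bot at_top"
      using \<beta> by (intro filterlim_tendsto_neg_mult_at_bot[OF tendsto_const] filterlim_ident) auto
    then have "((\<lambda>t. exp (- \<beta> * t)) \<longlongrightarrow> 0) at_top"
      by (rule filterlim_compose[OF exp_at_bot])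
    then show "((\<lambda>t. exp (- \<beta> * t) * (k + \<bar>e / \<beta>\<bar>)) \<longlongrightarrow> 0) at_top"
      by (rule tendsto_mult_left_zero)
  qed
  then have "q T \<le> 0"
    by (rule tendsto_lowerbound) (use mono in \<open>auto intro: eventually_mono[OF eventually_ge_at_top[of T]]\<close>)
  then show ?thesis
    by (simp add: q_def mult_le_0_iff)
qed

text \<open>The one-sided estimate is used for \<open>u\<close> with source \<open>H\<close> and for
  \<open>-u\<close> with source \<open>-H\<close>, from a point on where \<open>H\<close> is small.
  Boundedness excludes the growing homogeneous solution \<open>exp (\<beta> * t)\<close>.\<close>

lemma bounded_backward_tendsto_0:
  fixes u H :: "real \<Rightarrow> real"
  assumes \<beta>: "\<beta> > 0" and du: "\<And>t. t > 0 \<Longrightarrow> (u has_real_derivative \<beta> * u t - H t) (at t)"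
    and bd: "\<And>t. t > 0 \<Longrightarrow> \<bar>u t\<bar> \<le> k" and H: "(H \<longlongrightarrow> 0) at_top"
  shows "(u \<longlongrightarrow> 0) at_top"
proof (rule tendstoI)
  fix e :: real assume e: "e > 0"
  have "\<forall>\<^sub>F t in at_top. dist (H t) 0 < \<beta> * e / 2"
    using H \<beta> e by (intro tendstoD) auto
  then obtain T where T: "\<And>t. t \<ge> T \<Longrightarrow> \<bar>H t\<bar> < \<beta> * e / 2"
    by (auto simp: eventually_at_top_linorder)
  show "\<forall>\<^sub>F t in at_top. dist (u t) 0 < e"
    using eventually_gt_at_top[of 0] eventually_ge_at_top[of T]
  proof eventually_elim
    case (elim t)
    have HT: "\<bar>H s\<bar> < \<beta> * e / 2" if "s \<ge> t" for s
      using T that elim by auto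
    have "u t \<le> (\<beta> * e / 2) / \<beta>"
    proof (rule bounded_backward_le[OF \<beta> du bd elim(1)])
      show "H s \<le> \<beta> * e / 2" if "s \<ge> t" for s using HT[OF that] by linarith
    qed
    moreover have "- u t \<le> (\<beta> * e / 2) / \<beta>"
    proof (rule bounded_backward_le[where u="\<lambda>t. - u t" and H="\<lambda>t. - H t", OF \<beta> _ _ elim(1)])
      show "((\<lambda>t. - u t) has_real_derivative \<beta> * - u s - - H s) (at s)" if "s > 0" for s
        using DERIV_minus[OF du[OF that]] by simp
      show "\<bar>- u s\<bar> \<le> k" if "s > 0" for s using bd[OF that] by simp
      show "- H s \<le> \<beta> * e / 2" if "s \<ge> t" for s using HT[OF that] by linarith
    qed
    ultimately have "\<bar>u t\<bar> \<le> e / 2" using \<beta> by (simp add: abs_le_iff)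
    then show ?case using e by simp
  qed
qed

text \<open>The derivative of \<open>exp t * w t\<close> is \<open>exp t * u t\<close>, so
  l'Hospital's rule applied to \<open>exp t * w t / exp t\<close> leads back to the limit of
  \<open>u\<close>.\<close>

lemma forward_tendsto_0:
  fixes w u :: "real \<Rightarrow> real"
  assumes dw: "\<And>t. t > 0 \<Longrightarrow> (w has_real_derivative u t - w t) (at t)"
    and u: "(u \<longlongrightarrow> 0) at_top"
  shows "(w \<longlongrightarrow> 0) at_top"
proof -
  have "((\<lambda>t. (exp t * w t) / exp t) \<longlongrightarrow> 0) at_top"
  proof (rule lhospital_at_top_at_top[where g'=exp and f'="\<lambda>t. exp t * u t"])
    show "\<forall>\<^sub>F t in at_top. ((\<lambda>t. exp t * w t) has_real_derivative exp t * u t) (at t)"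
      using eventually_gt_at_top[of 0]
    proof eventually_elim
      case (elim t)
      show ?case using DERIV_mult[OF DERIV_exp dw[OF elim]] by (simp add: algebra_simps)
    qed
    show "((\<lambda>t. exp t * u t / exp t) \<longlongrightarrow> 0) at_top" using u by simp
  qed (auto intro: exp_at_top)
  then show ?thesis by simp
qed

section \<open>Existence by monotone iteration\<close>

lemma bounded_halfline:
  fixes f :: "real \<Rightarrow> real"
  assumes "continuous_on {0..} f" "(f \<longlongrightarrow> 0) at_top"
  obtains K where "K \<ge> 0" "\<And>t. t \<ge> 0 \<Longrightarrow> \<bar>f t\<bar> \<le> K"
proof -
  have "\<forall>\<^sub>F t in at_top. dist (f t) 0 < 1" using assms(2) by (rule tendstoD) auto
  then obtain T where T: "\<And>t. t \<ge> T \<Longrightarrow> \<bar>f t\<bar> < 1" by (auto simp: eventually_at_top_linorder)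
  have "compact (f ` {0..T})"
    by (intro compact_continuous_image continuous_on_subset[OF assms(1)]) auto
  then have "bounded (f ` {0..T})" by (rule compact_imp_bounded)
  then obtain C where C: "\<And>t. t \<in> {0..T} \<Longrightarrow> \<bar>f t\<bar> \<le> C"
    unfolding bounded_iff by fastforce
  show thesis
  proof
    show "max 1 C \<ge> 0" by simp
    show "\<bar>f t\<bar> \<le> max 1 C" if "t \<ge> 0" for t
      using T[of t] C[of t] that by (cases "t \<le> T") auto
  qed
qed

text \<open>Isolates what the argument uses of \<open>lam * h1\<close>: continuity, the bound by
  \<open>\<beta> / 2\<close>, and decay at infinity.\<close>

lemma halfline_bvp_exists:
  fixes f :: "real \<Rightarrow> real"
  assumes \<beta>: "\<beta> > 0" and f: "continuous_on {0..} f" and f_le: "\<And>t. t \<ge> 0 \<Longrightarrow> f t \<le> \<beta> / 2"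
    and f0: "(f \<longlongrightarrow> 0) at_top"
  shows "\<exists>w w1 w2. C2_halfline_derivs w w1 w2 \<and>
           (\<forall>t\<ge>0. - w2 t + (\<beta> - 1) * w1 t + \<beta> * w t = \<beta> / 2 * exp (- t) * (w t)\<^sup>2 + f t) \<and>
           w 0 = 0 \<and> (w \<longlongrightarrow> 0) at_top"
proof -
  obtain K where K: "K \<ge> 0" "\<And>t. t \<ge> 0 \<Longrightarrow> \<bar>f t\<bar> \<le> K"
    using bounded_halfline[OF f f0] by blast
  \<comment> \<open>Then \<open>- \<beta> * m = - K\<close> lies below \<open>f\<close>, and the
    quadratic term is nonnegative, so \<open>-m\<close> is a subsolution.\<close>
  define m where "m = K / \<beta>"
  have m: "m \<ge> 0" using K \<beta> by (simp add: m_def)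
  have f_ge: "- (\<beta> * m) \<le> f t" if "t \<ge> 0" for t
    using K(2)[OF that] \<beta> by (simp add: m_def abs_le_iff)
  \<comment> \<open>chosen so that \<open>-(D - b)(D + a) = -D\<^sup>2 + (\<beta> - 1) D + \<beta> + M\<close> and \<open>M \<ge> \<beta> m\<close>, which is what monotonicity needs\<close>
  define a b M where "a = 1 + m" and "b = m + \<beta>" and "M = m * (1 + m + \<beta>)"
  have a: "a > 0" and b: "b > 0" and M: "M \<ge> 0" and ab: "a * b = M + \<beta>"
    using m \<beta> by (auto simp: a_def b_def M_def algebra_simps)
  define \<Phi> where "\<Phi> w s = \<beta> / 2 * exp (- s) * (w s)\<^sup>2 + f s + M * w s" for w s
  define T where "T w = fwd a (bwd b (\<Phi> w))" for w
  define ok where "ok w \<longleftrightarrow> continuous_on {0..} w \<and> (\<forall>s\<ge>0. - m \<le> w s \<and> w s \<le> 1)"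
    for w :: "real \<Rightarrow> real"
  \<comment> \<open>The difference factors as \<open>w s - v s\<close> times
    \<open>\<beta> / 2 * exp (- s) * (w s + v s) + M\<close>. Since \<open>w s + v s\<close> is at
    least \<open>-2 m\<close>, the second factor is at least \<open>M - \<beta> * m\<close>.\<close>
  have mono: "\<Phi> v s \<le> \<Phi> w s" if "s \<ge> 0" "- m \<le> v s" "v s \<le> w s" for v w s
  proof -
    have "0 \<le> \<beta> / 2 * exp (- s) * (w s + v s) + M"
    proof -
      have "- (\<beta> * m) \<le> - (\<beta> * m * exp (- s))"
        using that m \<beta> by (simp add: mult_left_le)
      also have "\<dots> = \<beta> / 2 * exp (- s) * (- m + - m)" by simp
      also have "\<dots> \<le> \<beta> / 2 * exp (- s) * (w s + v s)"
        using that \<beta> by (intro mult_left_mono) auto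
      finally have "- (\<beta> * m) \<le> \<beta> / 2 * exp (- s) * (w s + v s)" .
      moreover have "\<beta> * m \<le> M" using m \<beta> by (simp add: M_def algebra_simps)
      ultimately show ?thesis by linarith
    qed
    then have "0 \<le> (w s - v s) * (\<beta> / 2 * exp (- s) * (w s + v s) + M)"
      using that by (intro mult_nonneg_nonneg) auto
    also have "\<dots> = \<Phi> w s - \<Phi> v s"
      by (simp add: \<Phi>_def field_simps power2_eq_square)
    finally show ?thesis by simp
  qed
  have \<Phi>_cont: "continuous_on {0..} (\<Phi> w)" if "continuous_on {0..} w" for w
    unfolding \<Phi>_def by (intro continuous_intros that f)
  \<comment> \<open>The shifted operator \<open>-(D - b)(D + a)\<close> sends the constant 1 to
    \<open>a * b\<close>. By monotonicity it suffices to test \<open>\<Phi>\<close> at the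
    constants, so this bound and the next express that 1 is a supersolution and \<open>-m\<close> a
    subsolution.\<close>
  have \<Phi>_le: "\<Phi> w s \<le> a * b" if "s \<ge> 0" "- m \<le> w s" "w s \<le> 1" for w s
  proof -
    have "\<Phi> w s \<le> \<Phi> (\<lambda>_. 1) s" using that by (intro mono) auto
    also have "\<dots> \<le> \<beta> / 2 + \<beta> / 2 + M"
    proof -
      have "\<beta> / 2 * exp (- s) \<le> \<beta> / 2"
        using that \<beta> by (intro mult_left_le) auto
      then show ?thesis using f_le[of s] that by (simp add: \<Phi>_def)
    qed
    finally show ?thesis by (simp add: ab)
  qed
  have \<Phi>_ge: "- m * (a * b) \<le> \<Phi> w s" if "s \<ge> 0" "- m \<le> w s" "w s \<le> 1" for w s
  proof -
    have "- m * (a * b) \<le> \<Phi> (\<lambda>_. - m) s"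
      using f_ge[of s] that \<beta> by (simp add: \<Phi>_def ab algebra_simps add_increasing2)
    also have "\<dots> \<le> \<Phi> w s" using that by (intro mono) auto
    finally show ?thesis .
  qed
  \<comment> \<open>The sum of the two one-sided bounds \<open>a * b\<close> and
    \<open>m * (a * b)\<close>; being independent of \<open>w\<close>, it dominates all iterates at
    once.\<close>
  define k where "k = (1 + m) * (a * b)"
  have \<Phi>_bd: "\<bar>\<Phi> w s\<bar> \<le> k" if "s \<ge> 0" "- m \<le> w s" "w s \<le> 1" for w s
  proof -
    have "0 \<le> a * b" "0 \<le> m * (a * b)" using a b m by auto
    moreover have "\<Phi> w s \<le> a * b" "- m * (a * b) \<le> \<Phi> w s"
      using that by (intro \<Phi>_le \<Phi>_ge; simp)+
    ultimately show ?thesis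
      by (auto simp: abs_le_iff k_def algebra_simps)
  qed
  have bwd_int: "(\<lambda>s. exp (- b * s) * \<Phi> w s) integrable_on {t..}" if "ok w" "t \<ge> 0" for w t
    using that by (intro bwd_integrable[where k=k] b \<Phi>_cont \<Phi>_bd) (auto simp: ok_def)
  have const_int: "(\<lambda>s. exp (- b * s) * c) integrable_on {t..}" for c t :: real
    using integrable_on_exp_minus_to_infinity[OF b, of t] by (rule integrable_on_mult_left)
  have V_cont: "continuous_on {0..} (bwd b (\<Phi> w))" if "ok w" for w
  proof (rule has_real_derivative_halfline_imp_continuous_on)
    show "(bwd b (\<Phi> w) has_real_derivative b * bwd b (\<Phi> w) t - \<Phi> w t) (at t within {0..})"
      if "t \<ge> 0" for t
      using \<open>ok w\<close> by (intro bwd_has_derivative \<Phi>_cont bwd_int that) (auto simp: ok_def)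
  qed
  \<comment> \<open>The constant bounds pass through both inverses: \<open>bwd b\<close> divides a
    constant by \<open>b\<close>, and \<open>fwd a\<close> multiplies it by
    \<open>(1 - exp (- a * t)) / a\<close>. Hence \<open>T\<close> maps functions with values in
    \<open>[-m, 1]\<close> to such functions.\<close>
  have V_le: "bwd b (\<Phi> w) t \<le> a" if "ok w" "t \<ge> 0" for w t
  proof -
    have "bwd b (\<Phi> w) t \<le> bwd b (\<lambda>_. a * b) t"
      using that by (intro bwd_mono bwd_int const_int \<Phi>_le) (auto simp: ok_def)
    then show ?thesis using b by (simp add: bwd_const)
  qed
  have V_ge: "- m * a \<le> bwd b (\<Phi> w) t" if "ok w" "t \<ge> 0" for w t
  proof -
    have "bwd b (\<lambda>_. - m * (a * b)) t \<le> bwd b (\<Phi> w) t"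
      using that by (intro bwd_mono bwd_int const_int \<Phi>_ge) (auto simp: ok_def)
    then show ?thesis using b by (simp add: bwd_const)
  qed
  have V_bd: "\<bar>bwd b (\<Phi> w) t\<bar> \<le> (1 + m) * a" if "ok w" "t \<ge> 0" for w t
  proof -
    have "0 \<le> m * a" using a m by auto
    with V_le[OF that] V_ge[OF that] a show ?thesis
      by (auto simp: abs_le_iff algebra_simps)
  qed
  have fconst_int: "(\<lambda>s. exp (a * s) * c) integrable_on {0..t}" for c t :: real
    by (intro integrable_continuous_real continuous_intros)
  have T_le: "T w t \<le> 1" if "ok w" "t \<ge> 0" for w t
  proof -
    have "T w t \<le> fwd a (\<lambda>_. a) t"
      unfolding T_def using that
      by (intro fwd_mono fwd_integrable V_cont fconst_int V_le) auto
    also have "\<dots> \<le> 1" using a that by (simp add: fwd_const)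
    finally show ?thesis .
  qed
  have T_ge: "- m \<le> T w t" if "ok w" "t \<ge> 0" for w t
  proof -
    have "m * (1 - exp (- (a * t))) \<le> m" using a that m by (intro mult_left_le) auto
    then have "- m \<le> fwd a (\<lambda>_. - m * a) t"
      using a that by (simp add: fwd_const)
    also have "\<dots> \<le> T w t"
      unfolding T_def using that
      by (intro fwd_mono fwd_integrable V_cont fconst_int V_ge) auto
    finally show ?thesis .
  qed
  have T_ok: "ok (T w)" if "ok w" for w
    unfolding ok_def using T_le[OF that] T_ge[OF that] V_cont[OF that]
    by (auto simp: T_def intro!: fwd_continuous fwd_integrable)
  have T_mono: "T v t \<le> T w t" if "ok v" "ok w" "\<And>s. s \<ge> 0 \<Longrightarrow> v s \<le> w s" for v w t
    unfolding T_def using that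
    by (intro fwd_mono fwd_integrable V_cont bwd_mono bwd_int mono) (auto simp: ok_def)
  define z where "z n = (T ^^ n) (\<lambda>_. - m)" for n
  have z_Suc: "z (Suc n) = T (z n)" for n by (simp add: z_def)
  have z_ok: "ok (z n)" for n
    by (induction n) (use m T_ok in \<open>auto simp: z_Suc, auto simp: z_def ok_def\<close>)
  have z_mono: "z n t \<le> z (Suc n) t" if "t \<ge> 0" for n t
    using that
  proof (induction n arbitrary: t)
    case 0
    \<comment> \<open>The base case is the subsolution property: the first iterate takes values in
      \<open>[-m, 1]\<close>, hence lies above the starting constant \<open>-m\<close>.\<close>
    then show ?case using z_ok[of "Suc 0"] by (simp add: z_def ok_def)
  next
    case (Suc n)
    then show ?case unfolding z_Suc[of n] z_Suc[of "Suc n"] by (intro T_mono z_ok T_ok) auto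
  qed
  define w where "w t = lim (\<lambda>n. z n t)" for t
  have z_lim: "(\<lambda>n. z n t) \<longlonglongrightarrow> w t" if "t \<ge> 0" for t
  proof -
    have "incseq (\<lambda>n. z n t)" using z_mono[OF that] by (rule incseq_SucI)
    moreover have "\<forall>n. z n t \<le> 1" using z_ok that by (auto simp: ok_def)
    ultimately obtain L where "(\<lambda>n. z n t) \<longlonglongrightarrow> L" using incseq_convergent by blast
    then show ?thesis unfolding w_def by (simp add: limI)
  qed
  have w_ge: "- m \<le> w t" if "t \<ge> 0" for t
    using z_lim[OF that] by (rule LIMSEQ_le_const) (use z_ok that in \<open>auto simp: ok_def\<close>)
  have w_le: "w t \<le> 1" if "t \<ge> 0" for t
    using z_lim[OF that] by (rule LIMSEQ_le_const2) (use z_ok that in \<open>auto simp: ok_def\<close>)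
  have \<Phi>_lim: "(\<lambda>n. \<Phi> (z n) s) \<longlonglongrightarrow> \<Phi> w s" if "s \<ge> 0" for s
    unfolding \<Phi>_def by (intro tendsto_intros z_lim that)
  have zc: "continuous_on {0..} (\<Phi> (z n))" for n
    using z_ok by (intro \<Phi>_cont) (auto simp: ok_def)
  have zb: "\<bar>\<Phi> (z n) s\<bar> \<le> k" if "s \<ge> 0" for n s
    using z_ok that by (intro \<Phi>_bd) (auto simp: ok_def)
  note V_lim = bwd_tendsto[OF b zc zb \<Phi>_lim]
  define v where "v = bwd b (\<Phi> w)"
  have v_lim: "(\<lambda>n. bwd b (\<Phi> (z n)) t) \<longlonglongrightarrow> v t" if "t \<ge> 0" for t
    unfolding v_def by (rule V_lim(2)) (use that in auto)
  note W_lim = fwd_tendsto[where v="\<lambda>n. bwd b (\<Phi> (z n))" and a=a, OF V_cont[OF z_ok] V_bd[OF z_ok] v_lim]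
  have w_eq: "w t = fwd a v t" if "t \<ge> 0" for t
  proof (rule LIMSEQ_unique)
    show "(\<lambda>n. z (Suc n) t) \<longlonglongrightarrow> w t" using z_lim[OF that] by (rule LIMSEQ_Suc)
    show "(\<lambda>n. z (Suc n) t) \<longlonglongrightarrow> fwd a v t"
      unfolding z_Suc T_def by (rule W_lim(2)) auto
  qed
  \<comment> \<open>So far \<open>w\<close> and \<open>v\<close> are only pointwise limits.
    Integrability of \<open>v\<close>, supplied by dominated convergence, makes
    \<open>fwd a v\<close> and hence \<open>w\<close> continuous; then \<open>\<Phi> w\<close> and
    \<open>v\<close> are continuous and the derivative formulas apply.\<close>
  have "continuous_on {0..} (fwd a v)"
    by (rule fwd_continuous, rule W_lim(1)) auto
  then have w_cont: "continuous_on {0..} w"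
    by (subst continuous_on_cong[OF refl w_eq]) auto
  have w_ok: "ok w" using w_cont w_ge w_le by (auto simp: ok_def)
  have v_cont: "continuous_on {0..} v" unfolding v_def by (rule V_cont[OF w_ok])
  have dv: "(v has_real_derivative b * v t - \<Phi> w t) (at t within {0..})" if "t \<ge> 0" for t
    unfolding v_def by (intro bwd_has_derivative \<Phi>_cont w_cont bwd_int w_ok that) auto
  \<comment> \<open>Both derivatives are read off the first-order system
    \<open>w' = v - a w\<close>, \<open>v' = b v - \<Phi> w\<close>, which makes their continuity
    immediate.\<close>
  define w1 where "w1 t = v t - a * w t" for t
  define w2 where "w2 t = b * v t - \<Phi> w t - a * w1 t" for t
  have dw: "(w has_real_derivative w1 t) (at t within {0..})" if "t \<ge> 0" for t
  proof -
    have "(fwd a v has_real_derivative w1 t) (at t within {0..})"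
      using fwd_has_derivative[OF v_cont that, of a] w_eq[OF that] by (simp add: w1_def)
    then show ?thesis
      by (rule has_field_derivative_transform_within[where d=1]) (use that w_eq in auto)
  qed
  have dw1: "(w1 has_real_derivative w2 t) (at t within {0..})" if "t \<ge> 0" for t
    unfolding w1_def w2_def by (auto intro!: derivative_eq_intros dv dw that simp: w1_def)
  have w2_cont: "continuous_on {0..} w2"
    unfolding w2_def w1_def by (intro continuous_intros v_cont w_cont \<Phi>_cont)
  \<comment> \<open>The unshifted right-hand side: eliminating \<open>v\<close> makes the terms in
    \<open>M\<close> cancel, because \<open>a * b = M + \<beta>\<close> and
    \<open>b - a = \<beta> - 1\<close>.\<close>
  define H where "H t = \<beta> / 2 * exp (- t) * (w t)\<^sup>2 + f t" for t
  have eq: "- w2 t + (\<beta> - 1) * w1 t + \<beta> * w t = H t" for t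
    by (simp add: w2_def w1_def H_def \<Phi>_def a_def b_def M_def algebra_simps power2_eq_square)
  have w_bd: "\<bar>w t\<bar> \<le> 1 + m" if "t \<ge> 0" for t
    using w_ge[OF that] w_le[OF that] m by (auto simp: abs_le_iff)
  have at: "at t within {0..} = at t" if "t > 0" for t :: real
    using that by (intro at_within_interior) auto
  have e0: "((\<lambda>t::real. exp (- t)) \<longlongrightarrow> 0) at_top"
    by (rule filterlim_compose[OF exp_at_bot filterlim_uminus_at_bot_at_top])
  have H0: "(H \<longlongrightarrow> 0) at_top"
  proof -
    have "((\<lambda>t. \<beta> / 2 * exp (- t) * (w t)\<^sup>2) \<longlongrightarrow> 0) at_top"
    proof (rule Lim_null_comparison)
      show "\<forall>\<^sub>F t in at_top. norm (\<beta> / 2 * exp (- t) * (w t)\<^sup>2) \<le> \<beta> / 2 * exp (- t) * (1 + m)\<^sup>2"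
        using eventually_ge_at_top[of 0]
      proof eventually_elim
        case (elim t)
        have "(w t)\<^sup>2 \<le> (1 + m)\<^sup>2" using w_bd[OF elim] by (rule power2_le_iff_abs_le[THEN iffD2, rotated]) (use m in auto)
        then show ?case using \<beta> by (simp add: abs_mult)
      qed
      have "((\<lambda>t. \<beta> / 2 * exp (- t) * (1 + m)\<^sup>2) \<longlongrightarrow> \<beta> / 2 * 0 * (1 + m)\<^sup>2) at_top"
        by (intro tendsto_intros e0)
      then show "((\<lambda>t. \<beta> / 2 * exp (- t) * (1 + m)\<^sup>2) \<longlongrightarrow> 0) at_top" by simp
    qed
    from tendsto_add[OF this f0] show ?thesis unfolding H_def by simp
  qed
  \<comment> \<open>The unshifted operator factors as \<open>-(D - \<beta>)(D + 1)\<close>, and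
    \<open>u\<close> is \<open>(D + 1) w\<close>.\<close>
  define u where "u t = w1 t + w t" for t
  have "(u \<longlongrightarrow> 0) at_top"
  proof (rule bounded_backward_tendsto_0[OF \<beta> _ _ H0])
    fix t :: real assume t: "t > 0"
    have "(u has_real_derivative w2 t + w1 t) (at t)"
      unfolding u_def using dw[of t] dw1[of t] t by (auto intro!: derivative_intros simp: at)
    also have "w2 t + w1 t = \<beta> * u t - H t"
      using eq[of t] by (simp add: u_def algebra_simps)
    finally show "(u has_real_derivative \<beta> * u t - H t) (at t)" .
    \<comment> \<open>With \<open>a = 1 + m\<close>, boundedness of \<open>u\<close> reduces to the
      bounds already known for \<open>v\<close> and \<open>w\<close>.\<close>
    have "u t = v t - m * w t" by (simp add: u_def w1_def a_def algebra_simps)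
    then have "\<bar>u t\<bar> \<le> \<bar>v t\<bar> + m * \<bar>w t\<bar>"
      using m abs_triangle_ineq4[of "v t" "m * w t"] by (simp add: abs_mult)
    also have "\<dots> \<le> (1 + m) * a + m * (1 + m)"
      using V_bd[OF w_ok, of t] w_bd[of t] t m by (intro add_mono mult_left_mono) (auto simp: v_def)
    finally show "\<bar>u t\<bar> \<le> (1 + m) * a + m * (1 + m)" .
  qed
  then have "(w \<longlongrightarrow> 0) at_top"
  proof (rule forward_tendsto_0[rotated])
    show "(w has_real_derivative u t - w t) (at t)" if "t > 0" for t
      using dw[of t] that by (simp add: at u_def)
  qed
  moreover have "w 0 = 0" using w_eq[of 0] by (simp add: fwd_def)
  moreover have "C2_halfline_derivs w w1 w2"
    unfolding C2_halfline_derivs_def using dw dw1 w2_cont by auto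
  ultimately show ?thesis using eq unfolding H_def by blast
qed

section \<open>The source term \<open>h1\<close> and the original problem\<close>

lemma h1_continuous_on_and_tendsto:
  assumes N: "N \<in> {2, 3}" and g: "set_integrable lebesgue {0..1} g"
  shows "continuous_on {0..} (h1 N g)" and "(h1 N g \<longlongrightarrow> 0) at_top"
proof -
  \<comment> \<open>Everything follows from the primitive \<open>P\<close>: it is continuous on
    \<open>[0, 1]\<close> with \<open>P 0 = 0\<close>, and for \<open>N\<close> at most 3 the
    exponential prefactor of \<open>h1\<close> is at most 1.\<close>
  define P where "P x = integral {0..x} g" for x
  have gi: "g integrable_on {0..1}" using g by (rule set_lebesgue_integral_eq_integral)
  have P_cont: "continuous_on {0..1} P"
    unfolding P_def by (rule indefinite_integral_continuous_1[OF gi])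
  have h1_eq: "h1 N g t = exp ((real N - 3) * t) * P (exp (- t))" if "t \<ge> 0" for t
  proof -
    have "set_integrable lebesgue {0..exp (- t)} g"
      using that by (intro set_integrable_subset[OF g]) auto
    then show ?thesis by (simp add: h1_def P_def set_lebesgue_integral_eq_integral)
  qed
  have "continuous_on {0..} (\<lambda>t. exp ((real N - 3) * t) * P (exp (- t)))"
    by (intro continuous_intros continuous_on_compose2[OF P_cont]) auto
  then show "continuous_on {0..} (h1 N g)"
    by (subst continuous_on_cong[OF refl h1_eq]) auto
  have e0: "((\<lambda>t::real. exp (- t)) \<longlongrightarrow> 0) at_top"
    by (rule filterlim_compose[OF exp_at_bot filterlim_uminus_at_bot_at_top])
  have "(P \<longlongrightarrow> P 0) (at 0 within {0..1})"
    using P_cont by (auto simp: continuous_on)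
  then have "((\<lambda>t. P (exp (- t))) \<longlongrightarrow> P 0) at_top"
  proof (rule filterlim_compose)
    show "filterlim (\<lambda>t::real. exp (- t)) (at 0 within {0..1}) at_top"
      unfolding filterlim_at using e0 eventually_ge_at_top[of 0]
      by (auto elim!: eventually_mono)
  qed
  then have P0: "((\<lambda>t. P (exp (- t))) \<longlongrightarrow> 0) at_top" by (simp add: P_def)
  show "(h1 N g \<longlongrightarrow> 0) at_top"
  proof (rule Lim_null_comparison[OF _ tendsto_norm_zero[OF P0]])
    show "\<forall>\<^sub>F t in at_top. norm (h1 N g t) \<le> norm (P (exp (- t)))"
      using eventually_ge_at_top[of 0]
    proof eventually_elim
      case (elim t)
      then have "exp ((real N - 3) * t) \<le> 1" using N by auto
      then have "exp ((real N - 3) * t) * \<bar>P (exp (- t))\<bar> \<le> \<bar>P (exp (- t))\<bar>"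
        by (intro mult_left_le_one_le) auto
      then show ?case using h1_eq[OF elim] by (simp add: abs_mult)
    qed
  qed
qed

theorem theorem5p3:
  fixes N :: nat and g :: "real \<Rightarrow> real" and lam :: real
  assumes "N \<in> {2, 3}"
    and "set_integrable lebesgue {0..1} g"
    and "\<forall>t>0. lam * h1 N g t \<le> (real N - 1) / 2"
  shows "\<exists>w. bvp_solution N g lam w"
proof -
  note h1 = h1_continuous_on_and_tendsto[OF assms(1,2)]
  define f where "f t = lam * h1 N g t" for t
  have f_cont: "continuous_on {0..} f"
    unfolding f_def by (intro continuous_intros h1)
  have f0: "(f \<longlongrightarrow> 0) at_top"
    unfolding f_def by (rule tendsto_mult_right_zero[OF h1(2)])
  \<comment> \<open>The hypothesis covers positive \<open>t\<close> only; the bound at 0 comes from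
    continuity through the right-hand limit.\<close>
  have "f 0 \<le> (real N - 1) / 2"
  proof (rule tendsto_upperbound)
    show "(f \<longlongrightarrow> f 0) (at_right 0)"
      using f_cont by (auto simp: continuous_on intro: tendsto_within_subset)
    show "\<forall>\<^sub>F t in at_right 0. f t \<le> (real N - 1) / 2"
      using eventually_at_right_less[of "0::real"]
      by eventually_elim (use assms(3) in \<open>simp add: f_def\<close>)
  qed simp
  then have f_le: "f t \<le> (real N - 1) / 2" if "t \<ge> 0" for t
    using assms(3) that by (cases "t = 0") (auto simp: f_def)
  have "real N - 1 > 0" using assms(1) by auto
  from halfline_bvp_exists[OF this f_cont f_le f0] obtain w w1 w2 where
    w: "C2_halfline_derivs w w1 w2" "w 0 = 0" "(w \<longlongrightarrow> 0) at_top"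
    and eq: "\<And>t. t \<ge> 0 \<Longrightarrow> - w2 t + (real N - 1 - 1) * w1 t + (real N - 1) * w t
                 = (real N - 1) / 2 * exp (- t) * (w t)\<^sup>2 + f t"
    by blast
  have "- w2 t + (real N - 2) * w1 t + (real N - 1) * w t
          = (real N - 1) / 2 * exp (- t) * (w t)\<^sup>2 + lam * h1 N g t" if "t > 0" for t
    using eq[of t] that by (simp add: f_def)
  then show ?thesis
    unfolding bvp_solution_def using w by blast
qed

end
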